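(* Let $\mu_0$ be an invariant probability measure on $M\times S$ for the discrete hybrid system $(Y_{nh})_{n\in\mathbb{N}}$ (the case $t_0=0$). For $t\in\mathbb{R}^+$ define a measure $\tilde\mu_t$ on $M$ by $$\tilde\mu_t(A)=\sum_{s\in S}\int_{x_0\in M}P\bigl(\varphi(t,x_0,s)\in A\bigr)\,d\mu_0(x_0,s),\qquad A\subseteq M\text{ Borel}.$$ Then $\tilde\mu_t$ is also invariant in the sense that $\tilde\mu_t=\tilde\mu_{t+nh}$ for all $n\in\mathbb{N}$.
   Context: $\mathbb{R}^+=[0,\infty)$ and $\mathbb{N}=\{0,1,2,\dots\}$. Let $M$ be a compact metric space, $S=\{s_1,\dots,s_{|S|}\}$ a finite discrete set, $h>0$. For each $s\in S$ let $\varphi_s:\mathbb{R}^+\times M\to M$ be a deterministic dynamical system: $\varphi_s(0,x)=x$, $\varphi_s(t+r,x)=\varphi_s(t,\varphi_s(r,x))$, and $x\mapsto\varphi_s(t,x)$ is continuous for each $t$. Let $(X_n)_{n\in\mathbb{N}}$ be an $S$-valued Markov chain with transition matrix $Q=(P_{i\to j})$, and let $Z_t=X_{\lfloor t/h\rfloor}$. For an initial position $x_0\in M$, initial state $Z_0=X_0=s\in S$, $t\in\mathbb{R}^+$ and $n=\lfloor t/h\rfloor$, the (random) position at time $t$ is $$x_t=\varphi(t,x_0,s)=\varphi_{Z_{nh}}\bigl(t-nh,\varphi_{Z_{(n-1)h}}(h,\dots\varphi_{Z_h}(h,\varphi_{Z_0}(h,x_0))\dots)\bigr),$$ and the hybrid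 system is $Y_t=(x_t,Z_t)\in M\times S$. $P(\varphi(t,x_0,s)\in A)$ is the probability, over the chain started at $X_0=s$, that the position at time $t$ lies in $A$. The notation $\sum_{s\in S}\int_{x_0\in M}\cdots\,d\mu_0(x_0,s)$ means the integral over $M\times S$ with respect to $\mu_0$. A probability measure $\mu_0$ on $M\times S$ is invariant for $(Y_{nh})_{n\in\mathbb{N}}$ if for all $n\in\mathbb{N}$ and Borel $B\subseteq M\times S$, $\mu_0(B)=\int_{M\times S}P(Y_{nh}\in B\mid Y_0=(x,s))\,d\mu_0(x,s)$. *)

theory Defs
  imports "HOL-Probability.Probability"
begin

definition semiflow :: "(real \<Rightarrow> 'm::metric_space \<Rightarrow> 'm) \<Rightarrow> bool" where
  "semiflow f \<longleftrightarrow>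
     (\<forall>x. f 0 x = x) \<and>
     (\<forall>t\<ge>0. \<forall>r\<ge>0. \<forall>x. f (t + r) x = f t (f r x)) \<and>
     (\<forall>t\<ge>0. continuous_on UNIV (f t))"

definition stochastic_matrix :: "real^'s^'s::finite \<Rightarrow> bool" where
  "stochastic_matrix Q \<longleftrightarrow> (\<forall>i j. Q $ i $ j \<ge> 0) \<and> (\<forall>i. (\<Sum>j\<in>UNIV. Q $ i $ j) = 1)"

definition markov_chain_from ::
    "real^'s^'s::finite \<Rightarrow> 's \<Rightarrow> 'w measure \<Rightarrow> (nat \<Rightarrow> 'w \<Rightarrow> 's) \<Rightarrow> bool" where
  "markov_chain_from Q s P X \<longleftrightarrow>
     prob_space P \<and>
     (\<forall>n. X n \<in> measurable P (count_space UNIV)) \<and>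
     (AE \<omega> in P. X 0 \<omega> = s) \<and>
     (\<forall>n i j. \<P>(\<omega> in P. \<forall>k\<le>n. X k \<omega> = i k) > 0 \<longrightarrow>
        \<P>(\<omega> in P. X (Suc n) \<omega> = j \<bar> \<forall>k\<le>n. X k \<omega> = i k) = Q $ i n $ j)"

definition switching :: "real \<Rightarrow> (nat \<Rightarrow> 'w \<Rightarrow> 's) \<Rightarrow> real \<Rightarrow> 'w \<Rightarrow> 's" where
  "switching h X t \<omega> = X (nat \<lfloor>t / h\<rfloor>) \<omega>"

primrec grid_position ::
    "('s \<Rightarrow> real \<Rightarrow> 'm \<Rightarrow> 'm) \<Rightarrow> real \<Rightarrow> (nat \<Rightarrow> 'w \<Rightarrow> 's) \<Rightarrow> nat \<Rightarrow> 'm \<Rightarrow> 'w \<Rightarrow> 'm" where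
  "grid_position \<phi> h X 0 x \<omega> = x"
| "grid_position \<phi> h X (Suc k) x \<omega> =
     \<phi> (switching h X (real k * h) \<omega>) h (grid_position \<phi> h X k x \<omega>)"

text \<open>The initial state does not occur as an argument: it is the value of \<open>X 0\<close>, prescribed
  by the law under which \<open>X\<close> is considered.\<close>

definition position ::
    "('s \<Rightarrow> real \<Rightarrow> 'm \<Rightarrow> 'm) \<Rightarrow> real \<Rightarrow> (nat \<Rightarrow> 'w \<Rightarrow> 's) \<Rightarrow> real \<Rightarrow> 'm \<Rightarrow> 'w \<Rightarrow> 'm" where
  "position \<phi> h X t x \<omega> =
     (let n = nat \<lfloor>t / h\<rfloor>
      in \<phi> (switching h X (real n * h) \<omega>) (t - real n * h) (grid_position \<phi> h X n x \<omega>))"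

definition hybrid ::
    "('s \<Rightarrow> real \<Rightarrow> 'm \<Rightarrow> 'm) \<Rightarrow> real \<Rightarrow> (nat \<Rightarrow> 'w \<Rightarrow> 's) \<Rightarrow> real \<Rightarrow> 'm \<Rightarrow> 'w \<Rightarrow> 'm \<times> 's" where
  "hybrid \<phi> h X t x \<omega> = (position \<phi> h X t x \<omega>, switching h X t \<omega>)"

text \<open>In the next two definitions \<open>P s\<close> is the law of the chain started in \<open>s\<close>, so conditioning on
  \<open>Y\<^sub>0 = (x, s)\<close> means using the measure \<open>P s\<close> and the initial position \<open>x\<close>.\<close>

definition invariant_hybrid_measure ::
    "('s::{finite,discrete_topology} \<Rightarrow> real \<Rightarrow> 'm::metric_space \<Rightarrow> 'm) \<Rightarrow> real \<Rightarrow>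
     ('s \<Rightarrow> 'w measure) \<Rightarrow> (nat \<Rightarrow> 'w \<Rightarrow> 's) \<Rightarrow> ('m \<times> 's) measure \<Rightarrow> bool" where
  "invariant_hybrid_measure \<phi> h P X \<mu> \<longleftrightarrow>
     sets \<mu> = sets borel \<and> prob_space \<mu> \<and>
     (\<forall>n::nat. \<forall>B\<in>sets borel. emeasure \<mu> B =
        (\<integral>\<^sup>+ (x, s). emeasure (P s) {\<omega> \<in> space (P s). hybrid \<phi> h X (real n * h) x \<omega> \<in> B} \<partial>\<mu>))"

definition position_measure ::
    "('s::{finite,discrete_topology} \<Rightarrow> real \<Rightarrow> 'm::metric_space \<Rightarrow> 'm) \<Rightarrow> real \<Rightarrow>
     ('s \<Rightarrow> 'w measure) \<Rightarrow> (nat \<Rightarrow> 'w \<Rightarrow> 's) \<Rightarrow> ('m \<times> 's) measure \<Rightarrow> real \<Rightarrow> 'm measure" where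
  "position_measure \<phi> h P X \<mu> t = measure_of UNIV (sets borel)
     (\<lambda>A. \<integral>\<^sup>+ (x, s). emeasure (P s) {\<omega> \<in> space (P s). position \<phi> h X t x \<omega> \<in> A} \<partial>\<mu>)"

text \<open>\<open>measure_of\<close> returns the null measure if the given set function is not a measure; under the
  standing assumptions it is one.\<close>

lemma position_joint_measurable:
  fixes \<phi> :: "'s::finite \<Rightarrow> real \<Rightarrow> 'm::metric_space \<Rightarrow> 'm"
  assumes h: "h > 0" and t: "t \<ge> 0"
    and flow: "\<And>s. semiflow (\<phi> s)"
    and X[measurable]: "\<And>n. X n \<in> measurable P (count_space UNIV)"
  shows "(\<lambda>z. position \<phi> h X t (fst z) (snd z)) \<in> borel \<Otimes>\<^sub>M P \<rightarrow>\<^sub>M borel"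
proof -
  have \<phi>: "\<phi> s r \<in> borel_measurable borel" if "r \<ge> 0" for s r
    using flow that by (auto simp: semiflow_def intro!: borel_measurable_continuous_onI)
  have sw[measurable]: "(\<lambda>z. switching h X r (snd z)) \<in> (borel :: 'm measure) \<Otimes>\<^sub>M P \<rightarrow>\<^sub>M count_space UNIV" for r
    unfolding switching_def by measurable
  have step: "(\<lambda>z. \<phi> (switching h X r (snd z)) u (g z)) \<in> borel \<Otimes>\<^sub>M P \<rightarrow>\<^sub>M borel"
    if g: "g \<in> (borel :: 'm measure) \<Otimes>\<^sub>M P \<rightarrow>\<^sub>M borel" and u: "u \<ge> 0" for r u g
    by (rule measurable_compose_countable[where f = "\<lambda>s z. \<phi> s u (g z)"])
      (auto intro: measurable_compose[OF g \<phi>[OF u]] sw)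
  have grid: "(\<lambda>z. grid_position \<phi> h X k (fst z) (snd z)) \<in> borel \<Otimes>\<^sub>M P \<rightarrow>\<^sub>M borel" for k
    by (induction k) (use h in \<open>auto intro!: step\<close>)
  have "real (nat \<lfloor>t / h\<rfloor>) \<le> t / h"
    using h t by (simp add: of_nat_nat)
  hence "real (nat \<lfloor>t / h\<rfloor>) * h \<le> t"
    using h by (simp add: field_simps)
  thus ?thesis
    unfolding position_def Let_def by (intro step grid) simp
qed

lemma emeasure_position_measure:
  fixes \<phi> :: "'s::{finite,discrete_topology} \<Rightarrow> real \<Rightarrow> 'm::metric_space \<Rightarrow> 'm"
  assumes h: "h > 0" and t: "t \<ge> 0"
    and flow: "\<And>s. semiflow (\<phi> s)"
    and chain: "\<And>s. markov_chain_from Q s (P s) X"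
    and \<mu>: "sets \<mu> = sets borel"
    and A: "A \<in> sets borel"
  shows "emeasure (position_measure \<phi> h P X \<mu> t) A =
    (\<integral>\<^sup>+ (x, s). emeasure (P s) {\<omega> \<in> space (P s). position \<phi> h X t x \<omega> \<in> A} \<partial>\<mu>)"
proof -
  let ?p = "\<lambda>A x s. emeasure (P s) {\<omega> \<in> space (P s). position \<phi> h X t x \<omega> \<in> A}"
  have joint: "(\<lambda>z. position \<phi> h X t (fst z) (snd z)) \<in> borel \<Otimes>\<^sub>M P s \<rightarrow>\<^sub>M borel" for s
    by (rule position_joint_measurable[OF h t flow])
      (use chain[of s] in \<open>simp add: markov_chain_from_def\<close>)
  have pos: "position \<phi> h X t x \<in> P s \<rightarrow>\<^sub>M borel" for x s
    using measurable_compose[OF measurable_Pair1'[of x borel "P s"] joint[of s]] by simp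
  have p_meas: "(\<lambda>x. ?p A x s) \<in> borel_measurable borel" if A: "A \<in> sets borel" for A s
  proof -
    interpret prob_space "P s" using chain[of s] by (simp add: markov_chain_from_def)
    let ?W = "(\<lambda>z. position \<phi> h X t (fst z) (snd z)) -` A \<inter> space (borel \<Otimes>\<^sub>M P s)"
    have "(\<lambda>x. emeasure (P s) (Pair x -` ?W)) \<in> borel_measurable borel"
      by (rule measurable_emeasure_Pair[OF measurable_sets[OF joint A]])
    moreover have "Pair x -` ?W = {\<omega> \<in> space (P s). position \<phi> h X t x \<omega> \<in> A}" for x
      by (auto simp: space_pair_measure)
    ultimately show ?thesis by simp
  qed
  have fst_m: "fst \<in> \<mu> \<rightarrow>\<^sub>M borel"
    using \<mu> by (simp cong: measurable_cong_sets add: borel_measurable_continuous_onI continuous_on_fst)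
  have "snd -` B \<in> sets borel" for B :: "'s set"
    by (intro borel_open open_vimage_snd Topological_Spaces.open_discrete)
  hence snd_m: "snd \<in> \<mu> \<rightarrow>\<^sub>M count_space UNIV"
    using \<mu> sets_eq_imp_space_eq[OF \<mu>] by (auto simp: measurable_def)
  have m: "(\<lambda>(x, s). ?p A x s) \<in> borel_measurable \<mu>" if A: "A \<in> sets borel" for A
    unfolding case_prod_beta
    by (rule measurable_compose_countable[where f = "\<lambda>s z. ?p A (fst z) s"])
      (auto intro: measurable_compose[OF fst_m p_meas[OF A]] snd_m)
  show ?thesis
    unfolding position_measure_def
  proof (rule emeasure_measure_of_sigma)
    show "sigma_algebra UNIV (sets (borel :: 'm measure))"
      using sets.sigma_algebra_axioms[of "borel :: 'm measure"] by simp
    show "positive (sets borel) (\<lambda>A. \<integral>\<^sup>+ (x, s). ?p A x s \<partial>\<mu>)"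
      by (simp add: positive_def case_prod_beta')
    show "countably_additive (sets borel) (\<lambda>A. \<integral>\<^sup>+ (x, s). ?p A x s \<partial>\<mu>)"
    proof (rule countably_additiveI)
      fix F :: "nat \<Rightarrow> 'm set"
      assume F: "range F \<subseteq> sets borel" "disjoint_family F"
      have "(\<Sum>i. \<integral>\<^sup>+ (x, s). ?p (F i) x s \<partial>\<mu>) = (\<integral>\<^sup>+ z. (\<Sum>i. case z of (x, s) \<Rightarrow> ?p (F i) x s) \<partial>\<mu>)"
        using F(1) by (intro nn_integral_suminf[symmetric] m) auto
      also have "\<dots> = (\<integral>\<^sup>+ (x, s). ?p (\<Union>i. F i) x s \<partial>\<mu>)"
      proof (intro nn_integral_cong, clarify)
        fix x s
        have "(\<Sum>i. ?p (F i) x s) = emeasure (P s) (\<Union>i. {\<omega> \<in> space (P s). position \<phi> h X t x \<omega> \<in> F i})"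
        proof (rule suminf_emeasure)
          have "{\<omega> \<in> space (P s). position \<phi> h X t x \<omega> \<in> F i} \<in> sets (P s)" for i
            using measurable_sets[OF pos[of x s], of "F i"] F(1)
            by (auto simp: vimage_def Int_def conj_commute)
          thus "range (\<lambda>i. {\<omega> \<in> space (P s). position \<phi> h X t x \<omega> \<in> F i}) \<subseteq> sets (P s)"
            by auto
          show "disjoint_family (\<lambda>i. {\<omega> \<in> space (P s). position \<phi> h X t x \<omega> \<in> F i})"
            using F(2) by (auto simp: disjoint_family_on_def)
        qed
        also have "(\<Union>i. {\<omega> \<in> space (P s). position \<phi> h X t x \<omega> \<in> F i}) =
            {\<omega> \<in> space (P s). position \<phi> h X t x \<omega> \<in> (\<Union>i. F i)}"
          by auto
        finally show "(\<Sum>i. ?p (F i) x s) = ?p (\<Union>i. F i) x s" .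
      qed
      finally show "(\<Sum>i. \<integral>\<^sup>+ (x, s). ?p (F i) x s \<partial>\<mu>) = (\<integral>\<^sup>+ (x, s). ?p (\<Union>i. F i) x s \<partial>\<mu>)" .
    qed
  qed (use A in auto)
qed

end

(* By the Markov property, conditioning on the first switch turns the law of the position at time
   t + h into the one-step transition operator of the hybrid chain applied to
   g (y, j) = P_j (position at time t from y lies in A). Invariance says that the integral of g
   with respect to the initial measure is unchanged by this operator; this is the case n = 1, and
   the general case follows by induction on n. *)

theory Submission imports Defs begin

section \<open>The Markov property at the first step\<close>

text \<open>The index map \<open>f\<close> lets one statement serve both the path from time 0
  (\<open>f\<close> the identity) and the path after the first switch
  (\<open>f = Suc\<close>).\<close>

lemma markov_chain_path_measurable:
  fixes X :: "nat \<Rightarrow> 'w \<Rightarrow> 's::finite" and m :: nat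
  assumes X: "\<And>n. X n \<in> P \<rightarrow>\<^sub>M count_space UNIV"
  shows "{\<omega> \<in> space P. \<forall>k\<le>m. X (f k) \<omega> = i k} \<in> sets P"
proof -
  have "{\<omega> \<in> space P. X (f k) \<omega> = i k} \<in> sets P" for k
    using measurable_sets[OF X[of "f k"], of "{i k}"] by (simp add: vimage_def Int_def conj_commute)
  hence "{\<omega> \<in> space P. \<forall>k\<in>{..m}. X (f k) \<omega> = i k} \<in> sets P"
    by (intro sets.sets_Collect_finite_All') auto
  thus ?thesis unfolding Ball_def atMost_iff .
qed

text \<open>This multiplies out the conditional probability in the Markov property, so that no
  conditioning is left in the later arguments.\<close>

lemma markov_chain_path_Suc:
  fixes X :: "nat \<Rightarrow> 'w \<Rightarrow> 's::finite"
  assumes chain: "markov_chain_from Q s P X"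
  shows "measure P {\<omega> \<in> space P. \<forall>k\<le>Suc m. X k \<omega> = i k} =
    measure P {\<omega> \<in> space P. \<forall>k\<le>m. X k \<omega> = i k} * Q $ i m $ i (Suc m)"
proof -
  interpret prob_space P using chain by (simp add: markov_chain_from_def)
  let ?C = "{\<omega> \<in> space P. \<forall>k\<le>m. X k \<omega> = i k}"
  let ?D = "{\<omega> \<in> space P. \<forall>k\<le>Suc m. X k \<omega> = i k}"
  have X: "X n \<in> P \<rightarrow>\<^sub>M count_space UNIV" for n
    using chain by (simp add: markov_chain_from_def)
  have sub: "measure P ?D \<le> measure P ?C"
  proof (rule finite_measure_mono)
    show "?D \<subseteq> ?C" by fastforce
    show "?C \<in> sets P"
      by (rule markov_chain_path_measurable[OF X, where f = "\<lambda>k. k"])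
  qed
  show ?thesis
  \<comment> \<open>Transition probabilities are prescribed only given pasts of positive
    probability. For a null past both sides vanish, since \<open>?D\<close> is contained in
    \<open>?C\<close>.\<close>
  proof (cases "measure P ?C = 0")
    case True
    with sub show ?thesis
      using measure_nonneg[of P ?D] by simp
  next
    case False
    hence pos: "measure P ?C > 0"
      by (simp add: zero_less_measure_iff)
    have "\<P>(\<omega> in P. X (Suc m) \<omega> = i (Suc m) \<bar> \<forall>k\<le>m. X k \<omega> = i k) = Q $ i m $ i (Suc m)"
      using chain pos by (simp add: markov_chain_from_def)
    moreover have "{\<omega> \<in> space P. X (Suc m) \<omega> = i (Suc m) \<and> (\<forall>k\<le>m. X k \<omega> = i k)} = ?D"
      by (auto simp only: le_Suc_eq)
    ultimately show ?thesis
      using pos by (simp add: cond_prob_def field_simps)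
  qed
qed

text \<open>The finite-dimensional distributions are determined by \<open>s\<close> and
  \<open>Q\<close> alone. This is what allows the laws \<open>P s\<close> for different initial
  states to be compared, as nothing else relates them.\<close>

lemma markov_chain_path_prob:
  fixes X :: "nat \<Rightarrow> 'w \<Rightarrow> 's::finite"
  assumes chain: "markov_chain_from Q s P X"
  shows "measure P {\<omega> \<in> space P. \<forall>k\<le>m. X k \<omega> = i k} =
    of_bool (i 0 = s) * (\<Prod>k<m. Q $ i k $ i (Suc k))"
proof (induction m)
  case 0
  interpret prob_space P using chain by (simp add: markov_chain_from_def)
  have X: "X n \<in> P \<rightarrow>\<^sub>M count_space UNIV" for n
    using chain by (simp add: markov_chain_from_def)
  have "measure P {\<omega> \<in> space P. X 0 \<omega> = i 0} = measure P {\<omega> \<in> space P. s = i 0}"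
    by (rule measure_eq_AE)
      (use chain markov_chain_path_measurable[OF X, where f = "\<lambda>k. k" and m = 0 and i = i] in \<open>auto simp: markov_chain_from_def\<close>)
  thus ?case
    by (cases "s = i 0") (auto simp: prob_space)
next
  case (Suc m)
  thus ?case
    by (simp only: markov_chain_path_Suc[OF chain] prod.lessThan_Suc mult.assoc)
qed

text \<open>By the product formula only the summand \<open>j = i 0\<close> survives on the right,
  and it supplies the first factor of the formula for the path \<open>s, i 0, i 1, ...\<close> under
  \<open>P s\<close>.\<close>

lemma markov_chain_path_first_step:
  fixes X :: "nat \<Rightarrow> 'w \<Rightarrow> 's::finite"
  assumes chain: "\<And>s. markov_chain_from Q s (P s) X"
  shows "measure (P s) {\<omega> \<in> space (P s). \<forall>k\<le>m. X (Suc k) \<omega> = i k} =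
    (\<Sum>j\<in>UNIV. Q $ s $ j * measure (P j) {\<omega> \<in> space (P j). \<forall>k\<le>m. X k \<omega> = i k})"
proof -
  \<comment> \<open>The path \<open>i\<close> preceded by \<open>s\<close>. Prefixing costs no
    probability because \<open>X 0 = s\<close> almost surely under \<open>P s\<close>.\<close>
  define i' where "i' = case_nat s i"
  have X: "X n \<in> P s \<rightarrow>\<^sub>M count_space UNIV" for n
    using chain[of s] by (simp add: markov_chain_from_def)
  have "measure (P s) {\<omega> \<in> space (P s). \<forall>k\<le>m. X (Suc k) \<omega> = i k} =
      measure (P s) {\<omega> \<in> space (P s). \<forall>k\<le>Suc m. X k \<omega> = i' k}"
  proof (rule measure_eq_AE)
    have eq: "(\<forall>k\<le>Suc m. X k \<omega> = i' k) \<longleftrightarrow> X 0 \<omega> = s \<and> (\<forall>k\<le>m. X (Suc k) \<omega> = i k)" for \<omega>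
      using All_less_Suc2[of "Suc m" "\<lambda>k. X k \<omega> = i' k"]
      by (simp only: less_Suc_eq_le i'_def nat.case)
    have "AE \<omega> in P s. X 0 \<omega> = s"
      using chain[of s] by (simp add: markov_chain_from_def)
    thus "AE \<omega> in P s. \<omega> \<in> {\<omega> \<in> space (P s). \<forall>k\<le>m. X (Suc k) \<omega> = i k} \<longleftrightarrow>
        \<omega> \<in> {\<omega> \<in> space (P s). \<forall>k\<le>Suc m. X k \<omega> = i' k}"
      by (rule eventually_mono) (simp add: eq)
  qed (rule markov_chain_path_measurable[OF X, where f = Suc] markov_chain_path_measurable[OF X, where f = "\<lambda>k. k"])+
  also have "\<dots> = Q $ s $ i 0 * (\<Prod>k<m. Q $ i k $ i (Suc k))"
    by (simp add: markov_chain_path_prob[OF chain] i'_def prod.lessThan_Suc_shift del: prod.lessThan_Suc)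
  also have "\<dots> = (\<Sum>j\<in>UNIV. Q $ s $ j * (of_bool (i 0 = j) * (\<Prod>k<m. Q $ i k $ i (Suc k))))"
  proof -
    let ?p = "\<Prod>k<m. Q $ i k $ i (Suc k)"
    have "(\<Sum>j\<in>UNIV. Q $ s $ j * (of_bool (i 0 = j) * ?p)) = (\<Sum>j\<in>UNIV. if i 0 = j then Q $ s $ j * ?p else 0)"
      by (intro sum.cong) auto
    thus ?thesis by simp
  qed
  finally show ?thesis
    by (simp only: markov_chain_path_prob[OF chain])
qed

section \<open>From single paths to events with a finite horizon\<close>

lemma measure_finite_path_event:
  fixes X :: "nat \<Rightarrow> 'w \<Rightarrow> 's::finite"
  assumes P: "prob_space P" and X: "\<And>n. X n \<in> P \<rightarrow>\<^sub>M count_space UNIV"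
    and R: "\<And>a b. (\<And>k. k \<le> m \<Longrightarrow> a k = b k) \<Longrightarrow> R a = R b"
  shows "{\<omega> \<in> space P. R (\<lambda>k. X k \<omega>)} \<in> sets P"
    and "measure P {\<omega> \<in> space P. R (\<lambda>k. X k \<omega>)} =
      (\<Sum>i | i \<in> {..m} \<rightarrow>\<^sub>E UNIV \<and> R i. measure P {\<omega> \<in> space P. \<forall>k\<le>m. X k \<omega> = i k})"
proof -
  interpret prob_space P by (rule P)
  let ?C = "\<lambda>i. {\<omega> \<in> space P. \<forall>k\<le>m. X k \<omega> = i k}"
  \<comment> \<open>Extensional functions give one representative per cylinder: the index set
    becomes finite and distinct indices have disjoint cylinders.\<close>
  let ?I = "{i. i \<in> {..m} \<rightarrow>\<^sub>E UNIV \<and> R i}"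
  have fin: "finite ?I"
    by (rule finite_subset[of _ "{..m} \<rightarrow>\<^sub>E (UNIV :: 's set)"]) (auto intro: finite_PiE)
  have C: "?C i \<in> sets P" for i
    using markov_chain_path_measurable[OF X, where f = "\<lambda>k. k"] .
  have eq: "{\<omega> \<in> space P. R (\<lambda>k. X k \<omega>)} = (\<Union>i\<in>?I. ?C i)"
  proof (intro set_eqI iffI)
    fix \<omega> assume \<omega>: "\<omega> \<in> {\<omega> \<in> space P. R (\<lambda>k. X k \<omega>)}"
    \<comment> \<open>The restricted path is \<open>undefined\<close> beyond \<open>m\<close>, where
      \<open>R\<close> does not look.\<close>
    have "R (restrict (\<lambda>k. X k \<omega>) {..m}) = R (\<lambda>k. X k \<omega>)"
      by (rule R) simp
    with \<omega> show "\<omega> \<in> (\<Union>i\<in>?I. ?C i)"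
      by (intro UN_I[of "restrict (\<lambda>k. X k \<omega>) {..m}"]) auto
  next
    fix \<omega> assume "\<omega> \<in> (\<Union>i\<in>?I. ?C i)"
    then obtain i where "\<omega> \<in> space P" "R i" "\<And>k. k \<le> m \<Longrightarrow> X k \<omega> = i k"
      by auto
    with R[of "\<lambda>k. X k \<omega>" i] show "\<omega> \<in> {\<omega> \<in> space P. R (\<lambda>k. X k \<omega>)}"
      by auto
  qed
  show "{\<omega> \<in> space P. R (\<lambda>k. X k \<omega>)} \<in> sets P"
    unfolding eq by (rule sets.finite_UN[OF fin C])
  have "disjoint_family_on ?C ?I"
    unfolding disjoint_family_on_def
  proof (intro ballI impI)
    fix i j assume ij: "i \<in> ?I" "j \<in> ?I" "i \<noteq> j"
    have "\<exists>k\<in>{..m}. i k \<noteq> j k"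
    proof (rule ccontr)
      assume "\<not> (\<exists>k\<in>{..m}. i k \<noteq> j k)"
      hence "i k = j k" if "k \<in> {..m}" for k
        using that by blast
      hence "i = j"
        using ij(1,2) by (intro PiE_ext[of i "{..m}" "\<lambda>_. UNIV" j]) simp_all
      with ij(3) show False ..
    qed
    then obtain k where "k \<le> m" "i k \<noteq> j k" by blast
    thus "?C i \<inter> ?C j = {}" by fastforce
  qed
  thus "measure P {\<omega> \<in> space P. R (\<lambda>k. X k \<omega>)} = (\<Sum>i\<in>?I. measure P (?C i))"
    unfolding eq by (intro finite_measure_finite_Union fin) (use C in blast)+
qed

text \<open>Both sides split into the finitely many cylinders on which \<open>R\<close> holds. The
  path formula applies to each, and the two finite sums are exchanged.\<close>

lemma markov_chain_first_step:
  fixes X :: "nat \<Rightarrow> 'w \<Rightarrow> 's::finite"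
  assumes chain: "\<And>s. markov_chain_from Q s (P s) X"
    and R: "\<And>a b. (\<And>k. k \<le> m \<Longrightarrow> a k = b k) \<Longrightarrow> R a = R b"
  shows "measure (P s) {\<omega> \<in> space (P s). R (\<lambda>k. X (Suc k) \<omega>)} =
    (\<Sum>j\<in>UNIV. Q $ s $ j * measure (P j) {\<omega> \<in> space (P j). R (\<lambda>k. X k \<omega>)})"
proof -
  have P: "prob_space (P s)" and X: "X n \<in> P s \<rightarrow>\<^sub>M count_space UNIV" for n s
    using chain[of s] by (simp_all add: markov_chain_from_def)
  let ?I = "{i. i \<in> {..m} \<rightarrow>\<^sub>E UNIV \<and> R i}"
  have "measure (P s) {\<omega> \<in> space (P s). R (\<lambda>k. X (Suc k) \<omega>)} =
      (\<Sum>i\<in>?I. measure (P s) {\<omega> \<in> space (P s). \<forall>k\<le>m. X (Suc k) \<omega> = i k})"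
    by (rule measure_finite_path_event(2)[OF P X R])
  also have "\<dots> = (\<Sum>j\<in>UNIV. \<Sum>i\<in>?I.
      Q $ s $ j * measure (P j) {\<omega> \<in> space (P j). \<forall>k\<le>m. X k \<omega> = i k})"
    unfolding markov_chain_path_first_step[OF chain] by (rule sum.swap)
  also have "\<dots> = (\<Sum>j\<in>UNIV. Q $ s $ j *
      (\<Sum>i\<in>?I. measure (P j) {\<omega> \<in> space (P j). \<forall>k\<le>m. X k \<omega> = i k}))"
    by (simp only: sum_distrib_left)
  also have "\<dots> = (\<Sum>j\<in>UNIV. Q $ s $ j * measure (P j) {\<omega> \<in> space (P j). R (\<lambda>k. X k \<omega>)})"
  proof (rule sum.cong[OF refl])
    fix j
    have "measure (P j) {\<omega> \<in> space (P j). R (\<lambda>k. X k \<omega>)} =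
        (\<Sum>i\<in>?I. measure (P j) {\<omega> \<in> space (P j). \<forall>k\<le>m. X k \<omega> = i k})"
      by (rule measure_finite_path_event(2)[OF P X R])
    thus "Q $ s $ j * (\<Sum>i\<in>?I. measure (P j) {\<omega> \<in> space (P j). \<forall>k\<le>m. X k \<omega> = i k}) =
        Q $ s $ j * measure (P j) {\<omega> \<in> space (P j). R (\<lambda>k. X k \<omega>)}"
      by (simp only:)
  qed
  finally show ?thesis .
qed

text \<open>The predicate reads the initial state and the later path separately. Under
  \<open>P s\<close> the former is almost surely \<open>s\<close>, and what remains concerns the
  shifted path only, where the first-step formula applies.\<close>

lemma emeasure_markov_chain_first_step:
  fixes X :: "nat \<Rightarrow> 'w \<Rightarrow> 's::finite"
  assumes chain: "\<And>s. markov_chain_from Q s (P s) X"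
    and Q: "stochastic_matrix Q"
    and R: "\<And>a b. (\<And>k. k \<le> m \<Longrightarrow> a k = b k) \<Longrightarrow> R s a = R s b"
    and R': "\<And>a b. (\<And>k. k \<le> Suc m \<Longrightarrow> a k = b k) \<Longrightarrow> R (a 0) (\<lambda>k. a (Suc k)) = R (b 0) (\<lambda>k. b (Suc k))"
  shows "emeasure (P s) {\<omega> \<in> space (P s). R (X 0 \<omega>) (\<lambda>k. X (Suc k) \<omega>)} =
    (\<Sum>j\<in>UNIV. ennreal (Q $ s $ j) * emeasure (P j) {\<omega> \<in> space (P j). R s (\<lambda>k. X k \<omega>)})"
proof -
  have P: "prob_space (P s)" and X: "X n \<in> P s \<rightarrow>\<^sub>M count_space UNIV" for n s
    using chain[of s] by (simp_all add: markov_chain_from_def)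
  have em: "emeasure (P j) B = ennreal (measure (P j) B)" for j B
    using P[of j] by (simp add: prob_space_def finite_measure.emeasure_eq_measure)
  have "emeasure (P s) {\<omega> \<in> space (P s). R (X 0 \<omega>) (\<lambda>k. X (Suc k) \<omega>)} =
      emeasure (P s) {\<omega> \<in> space (P s). R s (\<lambda>k. X (Suc k) \<omega>)}"
  proof (rule emeasure_eq_AE)
    have "AE \<omega> in P s. X 0 \<omega> = s"
      using chain[of s] by (simp add: markov_chain_from_def)
    thus "AE \<omega> in P s. \<omega> \<in> {\<omega> \<in> space (P s). R (X 0 \<omega>) (\<lambda>k. X (Suc k) \<omega>)} \<longleftrightarrow>
        \<omega> \<in> {\<omega> \<in> space (P s). R s (\<lambda>k. X (Suc k) \<omega>)}"
      by (rule eventually_mono) simp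
    show "{\<omega> \<in> space (P s). R (X 0 \<omega>) (\<lambda>k. X (Suc k) \<omega>)} \<in> sets (P s)"
      \<comment> \<open>Before \<open>X 0\<close> is replaced by \<open>s\<close>, the event reads
        the states up to index \<open>Suc m\<close>; \<open>R'\<close> provides its
        measurability.\<close>
      by (rule measure_finite_path_event(1)[where X = X and R = "\<lambda>a. R (a 0) (\<lambda>k. a (Suc k))", OF P X R'])
    show "{\<omega> \<in> space (P s). R s (\<lambda>k. X (Suc k) \<omega>)} \<in> sets (P s)"
      by (rule measure_finite_path_event(1)[OF P X R])
  qed
  also have "\<dots> = ennreal (\<Sum>j\<in>UNIV. Q $ s $ j * measure (P j) {\<omega> \<in> space (P j). R s (\<lambda>k. X k \<omega>)})"
    unfolding em by (subst markov_chain_first_step[where R = "R s", OF chain R]) auto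
  also have "\<dots> = (\<Sum>j\<in>UNIV. ennreal (Q $ s $ j) * emeasure (P j) {\<omega> \<in> space (P j). R s (\<lambda>k. X k \<omega>)})"
    using Q by (simp add: em stochastic_matrix_def flip: ennreal_mult sum_ennreal)
  finally show ?thesis .
qed

section \<open>Positions as functions of the switching path\<close>

lemma switching_grid: "h > 0 \<Longrightarrow> switching h X (real k * h) \<omega> = X k \<omega>"
  by (simp add: switching_def)

lemma grid_position_cong:
  assumes "h > 0" and "\<And>k. k < n \<Longrightarrow> X k \<omega> = X' k \<omega>'"
  shows "grid_position \<phi> h X n x \<omega> = grid_position \<phi> h X' n x \<omega>'"
  using assms(2) by (induction n) (simp_all add: switching_grid[OF assms(1)])

text \<open>The two processes may live on different sample spaces. This permits replacing the chain
  by the coordinate process on sequences, and it also shows that only finitely many states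
  matter.\<close>

lemma position_cong:
  assumes h: "h > 0" and eq: "\<And>k. k \<le> nat \<lfloor>t / h\<rfloor> \<Longrightarrow> X k \<omega> = X' k \<omega>'"
  shows "position \<phi> h X t x \<omega> = position \<phi> h X' t x \<omega>'"
proof -
  have "grid_position \<phi> h X (nat \<lfloor>t / h\<rfloor>) x \<omega> = grid_position \<phi> h X' (nat \<lfloor>t / h\<rfloor>) x \<omega>'"
    by (rule grid_position_cong[OF h], rule eq) simp
  thus ?thesis
    by (simp only: position_def Let_def switching_grid[OF h] eq[OF order_refl])
qed

text \<open>The recursion appends periods at the end of the path; the induction exposes the first
  period instead, which is the one to condition on.\<close>

lemma grid_position_Suc_shift:
  assumes h: "h > 0"
  shows "grid_position \<phi> h X (Suc n) x \<omega> =
    grid_position \<phi> h (\<lambda>k. X (Suc k)) n (\<phi> (X 0 \<omega>) h x) \<omega>"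
proof (induction n)
  case 0
  show ?case using switching_grid[OF h, of X 0] by simp
next
  case (Suc n)
  show ?case
    unfolding grid_position.simps(2)[of \<phi> h X "Suc n"] grid_position.simps(2)[of \<phi> h _ n "\<phi> (X 0 \<omega>) h x"]
      switching_grid[OF h] Suc.IH ..
qed

text \<open>Adding \<open>h\<close> raises the grid index by exactly one and leaves the time elapsed
  since the last grid point unchanged, so the additional period can be spent at the start.\<close>

lemma position_add_period:
  assumes h: "h > 0" and t: "t \<ge> 0"
  shows "position \<phi> h X (t + h) x \<omega> = position \<phi> h (\<lambda>k. X (Suc k)) t (\<phi> (X 0 \<omega>) h x) \<omega>"
proof -
  have "(t + h) / h = t / h + 1"
    using h by (simp add: field_simps)
  hence n: "nat \<lfloor>(t + h) / h\<rfloor> = Suc (nat \<lfloor>t / h\<rfloor>)"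
    using h t by (simp add: nat_add_distrib)
  have r: "t + h - real (Suc m) * h = t - real m * h" for m
    by (simp add: algebra_simps)
  show ?thesis
    unfolding position_def Let_def n switching_grid[OF h] grid_position_Suc_shift[OF h] r ..
qed

lemma emeasure_position_first_step:
  fixes \<phi> :: "'s::finite \<Rightarrow> real \<Rightarrow> 'm \<Rightarrow> 'm"
  assumes h: "h > 0" and t: "t \<ge> 0"
    and Q: "stochastic_matrix Q"
    and chain: "\<And>s. markov_chain_from Q s (P s) X"
  shows "emeasure (P s) {\<omega> \<in> space (P s). position \<phi> h X (t + h) x \<omega> \<in> A} =
    (\<Sum>j\<in>UNIV. ennreal (Q $ s $ j) *
      emeasure (P j) {\<omega> \<in> space (P j). position \<phi> h X t (\<phi> s h x) \<omega> \<in> A})"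
proof -
  \<comment> \<open>With the coordinate process \<open>\<lambda>k a. a k\<close> the sample point is
    the path itself, so the position becomes a function of the path. The argument \<open>s\<close>
    is the state that drives the first period.\<close>
  let ?R = "\<lambda>s a. position \<phi> h (\<lambda>k a. a k) t (\<phi> s h x) a \<in> A"
  have path: "position \<phi> h Y t y \<omega> = position \<phi> h (\<lambda>k a. a k) t y (\<lambda>k. Y k \<omega>)"
    for Y :: "nat \<Rightarrow> 'w \<Rightarrow> 's" and y \<omega>
    by (rule position_cong[OF h]) simp
  have dep: "?R s' a = ?R s' b" if "\<And>k. k \<le> nat \<lfloor>t / h\<rfloor> \<Longrightarrow> a k = b k" for s' a b
  proof -
    have "position \<phi> h (\<lambda>k a. a k) t y a = position \<phi> h (\<lambda>k a. a k) t y b" for y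
      by (rule position_cong[OF h], rule that)
    thus ?thesis by simp
  qed
  show ?thesis
    unfolding position_add_period[OF h t] path[of X] path[of "\<lambda>k. X (Suc k)"]
  proof (rule emeasure_markov_chain_first_step[OF chain Q, of "nat \<lfloor>t / h\<rfloor>" ?R])
    fix a b :: "nat \<Rightarrow> 's"
    assume "\<And>k. k \<le> Suc (nat \<lfloor>t / h\<rfloor>) \<Longrightarrow> a k = b k"
    thus "?R (a 0) (\<lambda>k. a (Suc k)) = ?R (b 0) (\<lambda>k. b (Suc k))"
      using dep[of "\<lambda>k. a (Suc k)" "\<lambda>k. b (Suc k)" "b 0"] by simp
  qed (rule dep)
qed

text \<open>The right-hand side is the transition kernel of the hybrid chain: move along the flow of
  \<open>s\<close> for time \<open>h\<close>, then draw the next state from row \<open>s\<close> of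
  \<open>Q\<close>.\<close>

lemma emeasure_hybrid_first_step:
  fixes \<phi> :: "'s::finite \<Rightarrow> real \<Rightarrow> 'm \<Rightarrow> 'm"
  assumes h: "h > 0" and flow: "\<And>s x. \<phi> s 0 x = x"
    and Q: "stochastic_matrix Q"
    and chain: "\<And>s. markov_chain_from Q s (P s) X"
  shows "emeasure (P s) {\<omega> \<in> space (P s). hybrid \<phi> h X h x \<omega> \<in> B} =
    (\<Sum>j\<in>UNIV. ennreal (Q $ s $ j) * indicator B (\<phi> s h x, j))"
proof -
  \<comment> \<open>At time exactly \<open>h\<close> the grid index is already 1, but the flow of
    the new state has run for time zero and is the identity.\<close>
  have hyb: "hybrid \<phi> h X h x \<omega> = (\<phi> (X 0 \<omega>) h x, X (Suc 0) \<omega>)" for \<omega>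
    using position_add_period[OF h order_refl, of \<phi> X x \<omega>] switching_grid[OF h, of X 1 \<omega>]
    by (simp add: hybrid_def position_def flow)
  have "emeasure (P j) {\<omega> \<in> space (P j). (y, X 0 \<omega>) \<in> B} = indicator B (y, j)" for y j
  proof -
    interpret prob_space "P j" using chain[of j] by (simp add: markov_chain_from_def)
    have [measurable]: "X 0 \<in> P j \<rightarrow>\<^sub>M count_space UNIV"
      using chain[of j] by (simp add: markov_chain_from_def)
    have "emeasure (P j) {\<omega> \<in> space (P j). (y, X 0 \<omega>) \<in> B} =
        emeasure (P j) {\<omega> \<in> space (P j). (y, j) \<in> B}"
    proof (rule emeasure_eq_AE)
      have "AE \<omega> in P j. X 0 \<omega> = j"
        using chain[of j] by (simp add: markov_chain_from_def)
      thus "AE \<omega> in P j. \<omega> \<in> {\<omega> \<in> space (P j). (y, X 0 \<omega>) \<in> B} \<longleftrightarrow>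
          \<omega> \<in> {\<omega> \<in> space (P j). (y, j) \<in> B}"
        by (rule eventually_mono) simp
      have "{\<omega> \<in> space (P j). X 0 \<omega> \<in> {i. (y, i) \<in> B}} \<in> sets (P j)"
        by measurable
      thus "{\<omega> \<in> space (P j). (y, X 0 \<omega>) \<in> B} \<in> sets (P j)" by simp
    qed simp
    thus ?thesis
      by (cases "(y, j) \<in> B") (auto simp: emeasure_space_1)
  qed
  moreover have "emeasure (P s) {\<omega> \<in> space (P s). (\<phi> (X 0 \<omega>) h x, X (Suc 0) \<omega>) \<in> B} =
      (\<Sum>j\<in>UNIV. ennreal (Q $ s $ j) * emeasure (P j) {\<omega> \<in> space (P j). (\<phi> s h x, X 0 \<omega>) \<in> B})"
    by (rule emeasure_markov_chain_first_step[OF chain Q, of 0 "\<lambda>s a. (\<phi> s h x, a 0) \<in> B"])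
      simp_all
  ultimately show ?thesis
    unfolding hyb by simp
qed

section \<open>Invariance tested against functions\<close>

lemma measurable_fst_borel:
  "fst \<in> (borel :: ('a::topological_space \<times> 'b::topological_space) measure) \<rightarrow>\<^sub>M borel"
  by (intro borel_measurable_continuous_onI continuous_on_fst continuous_on_id)

lemma measurable_snd_borel_discrete:
  "snd \<in> (borel :: ('a::topological_space \<times> 'b::discrete_topology) measure) \<rightarrow>\<^sub>M count_space UNIV"
  by (auto simp: measurable_def intro!: borel_open open_vimage_snd Topological_Spaces.open_discrete)

lemma measurable_hybrid_step:
  fixes f :: "'s::{finite,discrete_topology} \<Rightarrow> 'm::topological_space \<Rightarrow> 'm"
  assumes "\<And>s. continuous_on UNIV (f s)"
  shows "(\<lambda>z. (f (snd z) (fst z), j)) \<in> (borel :: ('m \<times> 's) measure) \<rightarrow>\<^sub>M (borel :: ('m \<times> 's) measure)"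
proof (rule measurable_compose_countable[where f = "\<lambda>s z. (f s (fst z), j)", OF _ measurable_snd_borel_discrete])
  show "(\<lambda>z. (f s (fst z), j)) \<in> (borel :: ('m \<times> 's) measure) \<rightarrow>\<^sub>M borel" for s
    by (intro borel_measurable_continuous_onI continuous_on_Pair continuous_on_const
        continuous_on_compose2[OF assms[of s]] continuous_on_fst continuous_on_id) simp
qed

text \<open>Invariance is given on sets only. Realising the image of \<open>\<mu>\<close> under the
  transition operator as a measure turns it into an equality of measures, which can then be
  integrated against any nonnegative Borel function.\<close>

lemma nn_integral_invariant_transition:
  fixes f :: "'s::{finite,discrete_topology} \<Rightarrow> 'm::topological_space \<Rightarrow> 'm"
    and q :: "'s \<Rightarrow> 's \<Rightarrow> ennreal" and \<mu> :: "('m \<times> 's) measure"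
  assumes f: "\<And>s. continuous_on UNIV (f s)" and \<mu>: "sets \<mu> = sets borel"
    and inv: "\<And>B. B \<in> sets borel \<Longrightarrow>
      emeasure \<mu> B = (\<integral>\<^sup>+ (x, s). (\<Sum>j\<in>UNIV. q s j * indicator B (f s x, j)) \<partial>\<mu>)"
    and g: "g \<in> borel_measurable borel"
  shows "(\<integral>\<^sup>+ z. g z \<partial>\<mu>) = (\<integral>\<^sup>+ (x, s). (\<Sum>j\<in>UNIV. q s j * g (f s x, j)) \<partial>\<mu>)"
proof -
  let ?C = "count_space (UNIV :: 's set)"
  let ?T = "\<lambda>p. (f (snd (fst p)) (fst (fst p)), snd p)"
  let ?q = "\<lambda>p. q (snd (fst p)) (snd p)"
  \<comment> \<open>The image of \<open>\<mu>\<close> after one step: adjoin a next state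
    \<open>j\<close> by counting measure, weight it by \<open>q s j\<close>, and push forward along
    \<open>((x, s), j)\<close> to \<open>(f s x, j)\<close>.\<close>
  define N where "N = distr (density (\<mu> \<Otimes>\<^sub>M ?C) ?q) borel ?T"
  have T: "?T \<in> \<mu> \<Otimes>\<^sub>M ?C \<rightarrow>\<^sub>M borel"
  proof (rule measurable_compose_countable[where f = "\<lambda>j p. (f (snd (fst p)) (fst (fst p)), j)" and g = snd])
    fix j :: 's
    have "(\<lambda>z. (f (snd z) (fst z), j)) \<in> \<mu> \<rightarrow>\<^sub>M borel"
      using measurable_hybrid_step[of f j, OF f] by (simp add: \<mu> cong: measurable_cong_sets)
    from measurable_compose[OF measurable_fst this]
    show "(\<lambda>p. (f (snd (fst p)) (fst (fst p)), j)) \<in> \<mu> \<Otimes>\<^sub>M ?C \<rightarrow>\<^sub>M borel" .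
  qed simp
  have q: "?q \<in> borel_measurable (\<mu> \<Otimes>\<^sub>M ?C)"
  proof (rule measurable_compose_countable[where f = "\<lambda>j p. q (snd (fst p)) j" and g = snd])
    fix j
    have "(\<lambda>z. q (snd z) j) \<in> borel_measurable \<mu>"
      using measurable_compose[OF measurable_snd_borel_discrete, of "\<lambda>s. q s j" borel]
      by (simp add: \<mu> cong: measurable_cong_sets)
    from measurable_compose[OF measurable_fst this]
    show "(\<lambda>p. q (snd (fst p)) j) \<in> borel_measurable (\<mu> \<Otimes>\<^sub>M ?C)" .
  qed simp
  interpret C: sigma_finite_measure ?C
    by (rule sigma_finite_measure_count_space_finite) simp
  \<comment> \<open>This is used twice: indicators yield \<open>N = \<mu>\<close>, and then
    \<open>u = g\<close> yields the claim.\<close>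
  have int: "(\<integral>\<^sup>+ z. u z \<partial>N) = (\<integral>\<^sup>+ (x, s). (\<Sum>j\<in>UNIV. q s j * u (f s x, j)) \<partial>\<mu>)"
    if u: "u \<in> borel_measurable borel" for u
  proof -
    have uT: "(\<lambda>p. u (?T p)) \<in> borel_measurable (\<mu> \<Otimes>\<^sub>M ?C)"
      by (rule measurable_compose[OF T u])
    have "(\<integral>\<^sup>+ z. u z \<partial>N) = (\<integral>\<^sup>+ p. u (?T p) \<partial>density (\<mu> \<Otimes>\<^sub>M ?C) ?q)"
      unfolding N_def by (rule nn_integral_distr) (use T u in simp_all)
    also have "\<dots> = (\<integral>\<^sup>+ p. ?q p * u (?T p) \<partial>(\<mu> \<Otimes>\<^sub>M ?C))"
      by (rule nn_integral_density[OF q uT])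
    also have "\<dots> = (\<integral>\<^sup>+ z. \<integral>\<^sup>+ j. ?q (z, j) * u (?T (z, j)) \<partial>?C \<partial>\<mu>)"
      by (rule C.nn_integral_fst[symmetric]) (intro borel_measurable_times_ennreal q uT)
    finally show ?thesis
      by (simp add: nn_integral_count_space_finite case_prod_beta')
  qed
  have "N = \<mu>"
  proof (rule measure_eqI)
    show "sets N = sets \<mu>" by (simp add: N_def \<mu>)
    fix B assume "B \<in> sets N"
    hence B: "B \<in> sets borel" by (simp add: N_def)
    have "emeasure N B = (\<integral>\<^sup>+ z. indicator B z \<partial>N)"
      using B by (simp add: N_def)
    also have "\<dots> = emeasure \<mu> B"
      unfolding inv[OF B] by (rule int) (use B in simp)
    finally show "emeasure N B = emeasure \<mu> B" .
  qed
  with int[OF g] show ?thesis by simp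
qed

text \<open>Invariance will be tested against this function. For a fixed state, its value at a point
  is the measure of a section of a jointly measurable set; the finitely many states are then glued
  together.\<close>

lemma measurable_position_prob:
  fixes \<phi> :: "'s::{finite,discrete_topology} \<Rightarrow> real \<Rightarrow> 'm::metric_space \<Rightarrow> 'm"
  assumes h: "h > 0" and t: "t \<ge> 0"
    and flow: "\<And>s. semiflow (\<phi> s)"
    and chain: "\<And>s. markov_chain_from Q s (P s) X"
    and A: "A \<in> sets borel"
  shows "(\<lambda>z. emeasure (P (snd z)) {\<omega> \<in> space (P (snd z)). position \<phi> h X t (fst z) \<omega> \<in> A})
    \<in> borel_measurable borel"
proof (rule measurable_compose_countable[OF _ measurable_snd_borel_discrete,
      where f = "\<lambda>s z. emeasure (P s) {\<omega> \<in> space (P s). position \<phi> h X t (fst z) \<omega> \<in> A}"])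
  fix s
  interpret prob_space "P s" using chain[of s] by (simp add: markov_chain_from_def)
  have "(\<lambda>z. position \<phi> h X t (fst z) (snd z)) \<in> borel \<Otimes>\<^sub>M P s \<rightarrow>\<^sub>M borel"
    by (rule position_joint_measurable[OF h t flow])
      (use chain[of s] in \<open>simp add: markov_chain_from_def\<close>)
  from measurable_emeasure_Pair[OF measurable_sets[OF this A]]
  have "(\<lambda>x. emeasure (P s) (Pair x -` ((\<lambda>z. position \<phi> h X t (fst z) (snd z)) -` A \<inter>
      space (borel \<Otimes>\<^sub>M P s)))) \<in> borel_measurable borel" .
  moreover have "Pair x -` ((\<lambda>z. position \<phi> h X t (fst z) (snd z)) -` A \<inter> space (borel \<Otimes>\<^sub>M P s)) =
      {\<omega> \<in> space (P s). position \<phi> h X t x \<omega> \<in> A}" for x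
    by (auto simp: space_pair_measure)
  ultimately have "(\<lambda>x. emeasure (P s) {\<omega> \<in> space (P s). position \<phi> h X t x \<omega> \<in> A}) \<in> borel_measurable borel"
    by simp
  from measurable_compose[OF measurable_fst_borel this]
  show "(\<lambda>z. emeasure (P s) {\<omega> \<in> space (P s). position \<phi> h X t (fst z) \<omega> \<in> A}) \<in> borel_measurable borel" .
qed

section \<open>Periodicity of the position measure\<close>

lemma position_measure_add_period:
  fixes \<phi> :: "'s::{finite,discrete_topology} \<Rightarrow> real \<Rightarrow> 'm::metric_space \<Rightarrow> 'm"
  assumes h: "h > 0" and t: "t \<ge> 0"
    and flow: "\<And>s. semiflow (\<phi> s)"
    and Q: "stochastic_matrix Q"
    and chain: "\<And>s. markov_chain_from Q s (P s) X"
    and inv: "invariant_hybrid_measure \<phi> h P X \<mu>"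
  shows "position_measure \<phi> h P X \<mu> (t + h) = position_measure \<phi> h P X \<mu> t"
proof (rule measure_eqI)
  have sets: "sets (position_measure \<phi> h P X \<mu> r) = sets borel" for r
    unfolding position_measure_def
    by (rule sigma_algebra.sets_measure_of_eq)
      (use sets.sigma_algebra_axioms[of "borel :: 'm measure"] in simp)
  show "sets (position_measure \<phi> h P X \<mu> (t + h)) = sets (position_measure \<phi> h P X \<mu> t)"
    by (simp only: sets)
  fix A assume "A \<in> sets (position_measure \<phi> h P X \<mu> (t + h))"
  hence A: "A \<in> sets borel" by (simp only: sets)
  have \<mu>: "sets \<mu> = sets borel"
    using inv by (simp add: invariant_hybrid_measure_def)
  have cont: "continuous_on UNIV (\<phi> s h)" and zero: "\<phi> s 0 x = x" for s x
    using flow[of s] h by (auto simp: semiflow_def)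
  let ?g = "\<lambda>z. emeasure (P (snd z)) {\<omega> \<in> space (P (snd z)). position \<phi> h X t (fst z) \<omega> \<in> A}"
  \<comment> \<open>The instance \<open>n = 1\<close> of invariance, with the law of the hybrid
    system at time \<open>h\<close> written through \<open>Q\<close>.\<close>
  have one_step: "emeasure \<mu> B =
      (\<integral>\<^sup>+ (x, s). (\<Sum>j\<in>UNIV. ennreal (Q $ s $ j) * indicator B (\<phi> s h x, j)) \<partial>\<mu>)"
    if "B \<in> sets borel" for B
  proof -
    have "emeasure \<mu> B =
        (\<integral>\<^sup>+ (x, s). emeasure (P s) {\<omega> \<in> space (P s). hybrid \<phi> h X (real 1 * h) x \<omega> \<in> B} \<partial>\<mu>)"
      using inv that unfolding invariant_hybrid_measure_def by blast
    thus ?thesis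
      by (simp add: emeasure_hybrid_first_step[where \<phi> = \<phi>, OF h zero Q chain])
  qed
  have "emeasure (position_measure \<phi> h P X \<mu> (t + h)) A =
      (\<integral>\<^sup>+ (x, s). emeasure (P s) {\<omega> \<in> space (P s). position \<phi> h X (t + h) x \<omega> \<in> A} \<partial>\<mu>)"
    by (rule emeasure_position_measure[OF h _ flow chain \<mu> A]) (use h t in simp)
  also have "\<dots> = (\<integral>\<^sup>+ (x, s). (\<Sum>j\<in>UNIV. ennreal (Q $ s $ j) * ?g (\<phi> s h x, j)) \<partial>\<mu>)"
    by (simp add: emeasure_position_first_step[OF h t Q chain])
  \<comment> \<open>Here invariance enters: the transition operator applied to \<open>?g\<close>
    integrates to the same value as \<open>?g\<close>.\<close>
  also have "\<dots> = (\<integral>\<^sup>+ z. ?g z \<partial>\<mu>)"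
    by (rule nn_integral_invariant_transition[symmetric, OF cont \<mu> one_step
          measurable_position_prob[OF h t flow chain A]])
  also have "\<dots> = emeasure (position_measure \<phi> h P X \<mu> t) A"
    unfolding emeasure_position_measure[OF h t flow chain \<mu> A] case_prod_beta ..
  finally show "emeasure (position_measure \<phi> h P X \<mu> (t + h)) A =
    emeasure (position_measure \<phi> h P X \<mu> t) A" .
qed

theorem theorem18:
  fixes \<phi> :: "'s::{finite,discrete_topology} \<Rightarrow> real \<Rightarrow> 'm::metric_space \<Rightarrow> 'm"
    and h t :: real
    and Q :: "((real, 's) vec, 's) vec"
    and P :: "'s \<Rightarrow> 'w measure"
    and X :: "nat \<Rightarrow> 'w \<Rightarrow> 's"
    and \<mu>\<^sub>0 :: "('m \<times> 's) measure"
    and n :: nat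
  assumes "compact (UNIV :: 'm set)"
    and "h > 0"
    and "\<And>s. semiflow (\<phi> s)"
    and "stochastic_matrix Q"
    and "\<And>s. markov_chain_from Q s (P s) X"
    and "invariant_hybrid_measure \<phi> h P X \<mu>\<^sub>0"
    and "t \<ge> 0"
  shows "position_measure \<phi> h P X \<mu>\<^sub>0 t = position_measure \<phi> h P X \<mu>\<^sub>0 (t + real n * h)"
proof (induction n)
  case 0
  show ?case by simp
next
  case (Suc n)
  have "position_measure \<phi> h P X \<mu>\<^sub>0 (t + real (Suc n) * h) =
      position_measure \<phi> h P X \<mu>\<^sub>0 ((t + real n * h) + h)"
    by (simp add: algebra_simps)
  \<comment> \<open>Periodicity is applied at the later time \<open>t + real n * h\<close>, which is
    again nonnegative.\<close>
  also have "\<dots> = position_measure \<phi> h P X \<mu>\<^sub>0 (t + real n * h)"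
    by (rule position_measure_add_period[OF assms(2) _ assms(3-6)]) (use assms(2,7) in simp)
  finally show ?case
    using Suc.IH by simp
qed

end
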